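(* Let $n\geq 1$ and suppose that $\Pi\subseteq\mathfrak{S}_{n}$ is invariant under the modified Foata--Strehl action. Then $$A(\Pi;t)=\left(\frac{1+yt}{1+y}\right)^{n+1}P^{(\mathrm{pk},\mathrm{des})}\left(\Pi;\frac{(1+y)^{2}t}{(y+t)(1+yt)},\frac{y+t}{1+yt}\right).$$ Equivalently, $$P^{(\mathrm{pk},\mathrm{des})}(\Pi;y,t)=\left(\frac{1+u}{1+uv}\right)^{n+1}A(\Pi;v),$$ where $$u=\frac{1+t^{2}-2yt-(1-t)\sqrt{(1+t)^{2}-4yt}}{2(1-y)t},\qquad v=\frac{(1+t)^{2}-2yt-(1+t)\sqrt{(1+t)^{2}-4yt}}{2yt}.$$
   Context: $\mathfrak{S}_n$ is the set of permutations $\pi=\pi_1\cdots\pi_n$ of $[n]=\{1,\dots,n\}$. For $\pi\in\mathfrak{S}_n$, $\mathrm{des}(\pi)$ is the number of $i\in[n-1]$ with $\pi_i>\pi_{i+1}$, and $\mathrm{pk}(\pi)$ is the number of $i$ with $2\le i\le n-1$ and $\pi_{i-1}<\pi_i>\pi_{i+1}$. For $\Pi\subseteq\mathfrak{S}_n$, $A(\Pi;t)=\sum_{\pi\in\Pi}t^{\mathrm{des}(\pi)+1}$ and $P^{(\mathrm{pk},\mathrm{des})}(\Pi;y,t)=\sum_{\pi\in\Pi}y^{\mathrm{pk}(\pi)+1}t^{\mathrm{des}(\pi)+1}$. Modified Foata--Strehl action. For $\pi\in\mathfrak{S}_n$ and $x\in[n]$, the $x$-factorization of $\pi$ is $\pi=w_1w_2xw_4w_5$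 (concatenation of words), where $w_2$ is the maximal consecutive subword immediately to the left of $x$ all of whose letters are smaller than $x$, and $w_4$ is the maximal consecutive subword immediately to the right of $x$ all of whose letters are smaller than $x$ (any of these words may be empty). Set $\varphi_x(\pi)=w_1w_4xw_2w_5$. Define $\varphi'_x(\pi)=\varphi_x(\pi)$ if exactly one of $w_2,w_4$ is nonempty (equivalently, if the letter $x$ is a double ascent or double descent of $\infty\pi\infty$, i.e. with $\pi_0=\pi_{n+1}=\infty$ and $x=\pi_i$ one has $\pi_{i-1}<\pi_i<\pi_{i+1}$ or $\pi_{i-1}>\pi_i>\pi_{i+1}$), and $\varphi'_x(\pi)=\pi$ otherwise. The maps $\varphi'_x$ are commuting involutions of $\mathfrak{S}_n$; for $S\subseteq[n]$ put $\varphi'_S=\prod_{x\in S}\varphi'_x$. The group $\mathbb{Z}_2^n$ acts on $\mathfrak{S}_n$ via the $\varphi'_S$, $S\subseteq[n]$; this is the modified Foata--Strehl action, and $\Pi$ is invariant if $\varphi'_S(\pi)\in\Pi$ for all $\pi\in\Pi$ and $S\subseteq[n]$. Here $y,t$ are indeterminates; the first identity is an identity of rational functions in $y,t$. In the second identity, $\sqrt{(1+t)^2-4yt}$ is the formal power series in $t$ over $\mathbb{Q}[y]$ with constant term $1$, so that $u$ and $v$ are formal power series in $t$ with coefficients in $\mathbb{Q}[y]$. *)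

theory Defs
  imports
    "HOL-Combinatorics.Multiset_Permutations"
    "HOL-Computational_Algebra.Computational_Algebra"
begin

text \<open>
  Permutations of \<open>[n]\<close> are handled as words, i.e. as the elements of
  \<^term>\<open>permutations_of_set {1..n}\<close>. The letters are 1, ..., n as usual, but positions in a
  list are counted from 0.
\<close>

section \<open>Statistics and generating polynomials\<close>

definition des :: "nat list \<Rightarrow> nat" where
  "des \<pi> = card {i. i + 1 < length \<pi> \<and> \<pi> ! i > \<pi> ! (i + 1)}"

definition pk :: "nat list \<Rightarrow> nat" where
  "pk \<pi> = card {i. 1 \<le> i \<and> i + 1 < length \<pi> \<and> \<pi> ! (i - 1) < \<pi> ! i \<and> \<pi> ! i > \<pi> ! (i + 1)}"

text \<open>
  The generating polynomials are evaluated at elements of an arbitrary commutative semiring, so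
  that rational functions and power series can be substituted for the indeterminates.
\<close>

definition A_poly :: "nat list set \<Rightarrow> 'a :: comm_semiring_1 \<Rightarrow> 'a" where
  "A_poly \<Omega> t = (\<Sum>\<pi>\<in>\<Omega>. t ^ (des \<pi> + 1))"

definition P_pk_des :: "nat list set \<Rightarrow> 'a :: comm_semiring_1 \<Rightarrow> 'a \<Rightarrow> 'a" where
  "P_pk_des \<Omega> y t = (\<Sum>\<pi>\<in>\<Omega>. y ^ (pk \<pi> + 1) * t ^ (des \<pi> + 1))"

section \<open>The modified Foata--Strehl action\<close>

text \<open>
  \<open>x_factorization x \<pi> = (w1, w2, w4, w5)\<close> where \<open>\<pi> = w1 @ w2 @ [x] @ w4 @ w5\<close>; it is meaningful
  when \<open>x\<close> occurs exactly once in \<open>\<pi>\<close>.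
\<close>

definition x_factorization ::
    "nat \<Rightarrow> nat list \<Rightarrow> nat list \<times> nat list \<times> nat list \<times> nat list" where
  "x_factorization x \<pi> =
     (let l = takeWhile (\<lambda>z. z \<noteq> x) \<pi>; r = tl (dropWhile (\<lambda>z. z \<noteq> x) \<pi>)
      in (rev (dropWhile (\<lambda>z. z < x) (rev l)), rev (takeWhile (\<lambda>z. z < x) (rev l)),
          takeWhile (\<lambda>z. z < x) r, dropWhile (\<lambda>z. z < x) r))"

definition FS :: "nat \<Rightarrow> nat list \<Rightarrow> nat list" where
  "FS x \<pi> = (case x_factorization x \<pi> of (w1, w2, w4, w5) \<Rightarrow> w1 @ w4 @ [x] @ w2 @ w5)"

definition modified_FS :: "nat \<Rightarrow> nat list \<Rightarrow> nat list" where
  "modified_FS x \<pi> =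
     (case x_factorization x \<pi> of (w1, w2, w4, w5) \<Rightarrow>
        if (w2 \<noteq> []) \<noteq> (w4 \<noteq> []) then FS x \<pi> else \<pi>)"

text \<open>
  The maps \<^term>\<open>modified_FS x\<close> commute on permutations, so the order of composition is
  immaterial there; we fix the increasing one.
\<close>

definition modified_FS_set :: "nat set \<Rightarrow> nat list \<Rightarrow> nat list" where
  "modified_FS_set S = fold modified_FS (sorted_list_of_set S)"

definition MFS_invariant :: "nat \<Rightarrow> nat list set \<Rightarrow> bool" where
  "MFS_invariant n \<Omega> \<longleftrightarrow> (\<forall>\<pi>\<in>\<Omega>. \<forall>S. S \<subseteq> {1..n} \<longrightarrow> modified_FS_set S \<pi> \<in> \<Omega>)"

section \<open>Indeterminates\<close>

text \<open>
  The field of rational functions in \<open>y\<close> and \<open>t\<close> over the rationals is the fraction field of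
  \<open>\<rat>[y][t]\<close>.
\<close>

definition y_rat :: "rat poly poly fract" where "y_rat = to_fract [:[:0, 1:]:]"
definition t_rat :: "rat poly poly fract" where "t_rat = to_fract [:0, 1:]"

text \<open>
  Power series in \<open>t\<close> over \<open>\<rat>[y]\<close> are viewed inside the fraction field of \<open>\<rat>[y][[t]]\<close>. There the
  quotients in the formulas for \<open>u\<close> and \<open>v\<close> are genuine quotients, whereas the library's division on
  power series requires a coefficient field and discards negative powers of \<open>t\<close>.
\<close>

definition y_ser :: "rat poly fps fract" where "y_ser = to_fract (fps_const [:0, 1:])"
definition t_ser :: "rat poly fps fract" where "t_ser = to_fract fps_X"

definition disc :: "rat poly fps" where
  "disc = (1 + fps_X)\<^sup>2 - 4 * fps_const [:0, 1:] * fps_X"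

definition sqrt_disc :: "rat poly fps" where
  "sqrt_disc = (THE s. s\<^sup>2 = disc \<and> fps_nth s 0 = 1)"

lemma fps_sqrt_ex1:
  fixes D :: "rat poly fps"
  assumes "fps_nth D 0 = 1"
  shows "\<exists>!s. s\<^sup>2 = D \<and> fps_nth s 0 = 1"
proof (rule ex_ex1I)
  define R where "R = wfrec less_than (\<lambda>f n. if n = 0 then (1 :: rat poly) else
      smult (1/2) (fps_nth D n - (\<Sum>i=1..n - 1. f i * f (n - i))))"
  have R: "R n = (if n = 0 then 1 else
      smult (1/2) (fps_nth D n - (\<Sum>i=1..n - 1. R i * R (n - i))))" for n
  proof -
    have "(\<Sum>i=1..n - 1. cut R less_than n i * cut R less_than n (n - i)) =
        (\<Sum>i=1..n - 1. R i * R (n - i))"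
      by (rule sum.cong) (auto simp: cut_def)
    then show ?thesis
      unfolding R_def by (subst wfrec) simp_all
  qed
  define s where "s = Abs_fps R"
  have "fps_nth (s\<^sup>2) n = fps_nth D n" for n
  proof (cases n)
    case 0
    then show ?thesis using assms R[of 0] by (simp add: s_def power2_eq_square)
  next
    case (Suc m)
    have e: "{0..n} = insert 0 (insert n {1..n - 1})" using Suc by auto
    have "fps_nth (s\<^sup>2) n = (\<Sum>i\<in>{0..n}. R i * R (n - i))"
      by (simp add: s_def power2_eq_square fps_mult_nth)
    also have "\<dots> = R 0 * R n + R n * R 0 + (\<Sum>i=1..n - 1. R i * R (n - i))"
      unfolding e using Suc by (subst sum.insert; simp)+
    also have "\<dots> = smult 2 (R n) + (\<Sum>i=1..n - 1. R i * R (n - i))"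
      using R[of 0] smult_add_left[of 1 1 "R n"] by simp
    also have "smult 2 (R n) = fps_nth D n - (\<Sum>i=1..n - 1. R i * R (n - i))"
      using Suc by (subst R) simp
    finally show ?thesis by simp
  qed
  then have "s\<^sup>2 = D \<and> fps_nth s 0 = 1"
    using R[of 0] by (auto simp: fps_eq_iff s_def)
  then show "\<exists>s. s\<^sup>2 = D \<and> fps_nth s 0 = 1" by blast
next
  fix s s' :: "rat poly fps"
  assume a: "s\<^sup>2 = D \<and> fps_nth s 0 = 1" and b: "s'\<^sup>2 = D \<and> fps_nth s' 0 = 1"
  then have "s = s' \<or> s = - s'" by (metis power2_eq_iff)
  moreover have "s \<noteq> - s'"
  proof
    assume "s = - s'"
    then have "fps_nth s 0 = - fps_nth s' 0" by simp
    then show False using a b by simp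
  qed
  ultimately show "s = s'" by blast
qed

lemma sqrt_disc_square: "sqrt_disc\<^sup>2 = disc"
  and sqrt_disc_nth_0: "fps_nth sqrt_disc 0 = 1"
proof -
  have "fps_nth disc 0 = 1"
    by (simp add: disc_def power2_eq_square)
  from theI'[OF fps_sqrt_ex1[OF this]]
  show "sqrt_disc\<^sup>2 = disc" "fps_nth sqrt_disc 0 = 1" by (simp_all add: sqrt_disc_def)
qed

definition u_ser :: "rat poly fps fract" where
  "u_ser = (1 + t_ser\<^sup>2 - 2 * y_ser * t_ser - (1 - t_ser) * to_fract sqrt_disc)
             / (2 * (1 - y_ser) * t_ser)"

definition v_ser :: "rat poly fps fract" where
  "v_ser = ((1 + t_ser)\<^sup>2 - 2 * y_ser * t_ser - (1 + t_ser) * to_fract sqrt_disc)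
             / (2 * y_ser * t_ser)"

end

(*
  The letters of a permutation of [n] that are followed by a smaller letter number des, those
  that are preceded by a smaller letter number n - 1 - des, and the peaks are the letters in both
  sets.  The map phi'_x moves x between the two sets if it is in exactly one of them, and does
  nothing else to the sets.  Averaging over these involutions, one letter at a time, gives
    P(y, t) = sum over pi of (y t)^(pk + 1) ((1 + t) / 2)^(n - 1 - 2 pk).
  The right-hand side is multiplied by a^(n + 1) when y t and 1 + t are multiplied by a^2 and a,
  and both identities are instances of this: Y T = a^2 t and 1 + T = a (1 + t) imply
  P(Y, T) = a^(n + 1) P(1, t) = a^(n + 1) A(t).
  That u and v are power series is seen by multiplying the numerator with its conjugate, which
  has constant term 2 and is therefore a unit.
*)
theory Submission
  imports Defs
begin

section \<open>Descent tops and ascent tops of a word\<close>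

text \<open>Letters are collected rather than positions because the action moves letters around: the
  sets before and after a move can then be compared directly.\<close>

definition descent_tops :: "'a :: linorder list \<Rightarrow> 'a set" where
  "descent_tops xs = (!) xs ` {i. i + 1 < length xs \<and> xs ! i > xs ! (i + 1)}"

lemma descent_tops_Nil [simp]: "descent_tops [] = {}"
  and descent_tops_single [simp]: "descent_tops [a] = {}"
  by (auto simp: descent_tops_def)

lemma descent_tops_Cons:
  "descent_tops (a # b # xs) = (if a > b then {a} else {}) \<union> descent_tops (b # xs)"
proof -
  have *: "{i. i + 1 < length (a # b # xs) \<and> (a # b # xs) ! i > (a # b # xs) ! (i + 1)} =
      (if a > b then {0} else {}) \<union>
      Suc ` {i. i + 1 < length (b # xs) \<and> (b # xs) ! i > (b # xs) ! (i + 1)}"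
    (is "?L = ?R")
  proof (rule set_eqI)
    show "i \<in> ?L \<longleftrightarrow> i \<in> ?R" for i by (cases i) auto
  qed
  show ?thesis
    unfolding descent_tops_def * image_Un image_image by auto
qed

lemma descent_tops_append:
  "descent_tops (xs @ ys) = descent_tops xs \<union> descent_tops ys \<union>
     (if xs \<noteq> [] \<and> ys \<noteq> [] \<and> last xs > hd ys then {last xs} else {})"
proof (induction xs rule: induct_list012)
  case (2 a)
  then show ?case by (cases ys) (auto simp: descent_tops_Cons)
qed (auto simp: descent_tops_Cons)

lemma descent_tops_subset: "descent_tops xs \<subseteq> set xs"
  by (auto simp: descent_tops_def)

lemma finite_descent_tops [simp]: "finite (descent_tops xs)"
  by (rule finite_subset[OF descent_tops_subset]) simp

text \<open>Descent tops of the reversed word are the ascent tops, that is, the letters preceded by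
  a smaller one. Expressing them through \<open>rev\<close> lets each fact about descent tops be
  reused for the left-hand side of a letter.\<close>

lemma descent_tops_rev:
  "descent_tops (rev xs) = (\<lambda>i. xs ! (i + 1)) ` {i. i + 1 < length xs \<and> xs ! i < xs ! (i + 1)}"
proof (intro equalityI subsetI)
  fix x assume "x \<in> descent_tops (rev xs)"
  then obtain i where i: "i + 1 < length xs" "rev xs ! i > rev xs ! (i + 1)" "x = rev xs ! i"
    by (auto simp: descent_tops_def)
  \<comment> \<open>Reversal carries the positions \<open>i\<close> and \<open>i + 1\<close> to
    \<open>j + 1\<close> and \<open>j\<close>.\<close>
  define j where "j = length xs - Suc (Suc i)"
  have "j + 1 < length xs" "xs ! j < xs ! (j + 1)" "x = xs ! (j + 1)"
    using i by (auto simp: j_def rev_nth Suc_diff_Suc)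
  then show "x \<in> (\<lambda>i. xs ! (i + 1)) ` {i. i + 1 < length xs \<and> xs ! i < xs ! (i + 1)}" by blast
next
  fix x assume "x \<in> (\<lambda>i. xs ! (i + 1)) ` {i. i + 1 < length xs \<and> xs ! i < xs ! (i + 1)}"
  then obtain i where i: "i + 1 < length xs" "xs ! i < xs ! (i + 1)" "x = xs ! (i + 1)"
    by blast
  define j where "j = length xs - Suc (Suc i)"
  have "j + 1 < length (rev xs)" "rev xs ! j > rev xs ! (j + 1)" "x = rev xs ! j"
    using i by (auto simp: j_def rev_nth Suc_diff_Suc)
  then show "x \<in> descent_tops (rev xs)" unfolding descent_tops_def by blast
qed

lemma des_eq_card_descent_tops:
  assumes "distinct \<pi>"
  shows "des \<pi> = card (descent_tops \<pi>)"
  unfolding des_def descent_tops_def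
  by (rule card_image[symmetric], rule inj_on_subset[OF inj_on_nth[OF assms, of "{..<length \<pi>}"]]) auto

text \<open>A peak is a descent top and an ascent top at once. Distinctness ensures that both
  memberships of a letter come from the same position.\<close>

lemma pk_eq_card:
  assumes "distinct \<pi>"
  shows "pk \<pi> = card (descent_tops \<pi> \<inter> descent_tops (rev \<pi>))"
proof -
  define I where "I = {i. 1 \<le> i \<and> i + 1 < length \<pi> \<and> \<pi> ! (i - 1) < \<pi> ! i \<and> \<pi> ! i > \<pi> ! (i + 1)}"
  have "descent_tops \<pi> \<inter> descent_tops (rev \<pi>) = (!) \<pi> ` I"
  proof (intro equalityI subsetI)
    fix x assume "x \<in> descent_tops \<pi> \<inter> descent_tops (rev \<pi>)"
    then obtain i j where ij: "i + 1 < length \<pi>" "\<pi> ! i > \<pi> ! (i + 1)" "x = \<pi> ! i"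
      "j + 1 < length \<pi>" "\<pi> ! j < \<pi> ! (j + 1)" "x = \<pi> ! (j + 1)"
      unfolding descent_tops_rev by (auto simp: descent_tops_def)
    then have "i = j + 1" using assms by (simp add: nth_eq_iff_index_eq)
    then have "i \<in> I" using ij by (auto simp: I_def)
    then show "x \<in> (!) \<pi> ` I" using ij by blast
  next
    fix x assume "x \<in> (!) \<pi> ` I"
    then obtain i where i: "i \<in> I" "x = \<pi> ! i" by blast
    then have "x = \<pi> ! (i - 1 + 1)" "i - 1 \<in> {i. i + 1 < length \<pi> \<and> \<pi> ! i < \<pi> ! (i + 1)}"
      by (auto simp: I_def)
    then have "x \<in> descent_tops (rev \<pi>)"
      unfolding descent_tops_rev by blast
    moreover have "x \<in> descent_tops \<pi>"
      using i by (auto simp: I_def descent_tops_def)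
    ultimately show "x \<in> descent_tops \<pi> \<inter> descent_tops (rev \<pi>)" by blast
  qed
  moreover have "inj_on ((!) \<pi>) I"
    by (rule inj_on_subset[OF inj_on_nth[OF assms, of "{..<length \<pi>}"]]) (auto simp: I_def)
  ultimately show ?thesis by (simp add: card_image pk_def I_def)
qed

text \<open>Each of the \<open>length xs - 1\<close> adjacent pairs is either a descent or an
  ascent, as ties are excluded, and contributes its greater letter to exactly one of the two
  sets.\<close>

lemma card_descent_tops_rev:
  assumes "distinct xs"
  shows "card (descent_tops xs) + card (descent_tops (rev xs)) = length xs - 1"
proof -
  let ?D = "{i. i + 1 < length xs \<and> xs ! i > xs ! (i + 1)}"
  let ?A = "{i. i + 1 < length xs \<and> xs ! i < xs ! (i + 1)}"
  have "card (descent_tops xs) = card ?D"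
    unfolding descent_tops_def
    by (rule card_image, rule inj_on_subset[OF inj_on_nth[OF assms, of "{..<length xs}"]]) auto
  moreover have "card (descent_tops (rev xs)) = card ?A"
    unfolding descent_tops_rev
    by (rule card_image) (use assms in \<open>auto simp: inj_on_def nth_eq_iff_index_eq\<close>)
  moreover have "card ?D + card ?A = card (?D \<union> ?A)"
    by (subst card_Un_disjoint) (auto intro: finite_subset[of _ "{..<length xs}"])
  moreover have "?D \<union> ?A = {..<length xs - 1}"
  proof (rule set_eqI)
    fix i
    have "xs ! i > xs ! (i + 1) \<or> xs ! i < xs ! (i + 1)" if "i + 1 < length xs"
      using assms that by (simp add: nth_eq_iff_index_eq neq_iff[symmetric])
    then show "i \<in> ?D \<union> ?A \<longleftrightarrow> i \<in> {..<length xs - 1}"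
      by (cases "i + 1 < length xs") (simp_all add: less_diff_conv)
  qed
  ultimately show ?thesis by simp
qed

lemma descent_tops_Cons_less:
  "ys \<noteq> [] \<Longrightarrow> hd ys < x \<Longrightarrow> descent_tops (x # ys) = insert x (descent_tops ys)"
  by (cases ys) (auto simp: descent_tops_Cons)

lemma descent_tops_Cons_greater:
  "ys = [] \<or> x < hd ys \<Longrightarrow> descent_tops (x # ys) = descent_tops ys"
  by (cases ys) (auto simp: descent_tops_Cons)

text \<open>If \<open>w1\<close> is nonempty, its last letter exceeds \<open>x\<close> and all of
  \<open>w\<close>, so it is a descent top whichever of them follows. No descent leads into
  \<open>w5\<close>, from \<open>w\<close> or from \<open>x\<close>. Hence only the status of
  \<open>x\<close> changes.\<close>

lemma descent_tops_move:
  assumes "w \<noteq> []" "\<forall>z\<in>set w. z < x" "w1 = [] \<or> x < last w1" "w5 = [] \<or> x < hd w5"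
  shows "descent_tops (w1 @ x # w @ w5) = insert x (descent_tops (w1 @ w @ x # w5))"
proof -
  have ends: "last w < x" "hd w < x" using assms(1,2) by auto
  have prefix: "descent_tops (w1 @ v) =
      descent_tops w1 \<union> descent_tops v \<union> (if w1 = [] then {} else {last w1})"
    if "v \<noteq> []" "hd v \<le> x" for v
  proof (cases "w1 = []")
    case False
    then have "hd v < last w1" using assms(3) that(2) by auto
    then show ?thesis using False that(1) by (simp add: descent_tops_append)
  qed simp
  have "\<not> (w5 \<noteq> [] \<and> hd w5 < last w)" using assms(4) ends by auto
  then have "descent_tops (w @ w5) = descent_tops w \<union> descent_tops w5"
    by (auto simp: descent_tops_append)
  moreover have "descent_tops (x # w @ w5) = insert x (descent_tops (w @ w5))"
    using assms(1) ends by (intro descent_tops_Cons_less) simp_all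
  moreover have "descent_tops (w @ x # w5) = descent_tops w \<union> descent_tops (x # w5)"
    using ends by (auto simp: descent_tops_append)
  moreover have "descent_tops (x # w5) = descent_tops w5"
    using assms(4) by (rule descent_tops_Cons_greater)
  moreover have "hd (w @ x # w5) \<le> x" using assms(1) ends by simp
  ultimately show ?thesis by (simp add: prefix)
qed

lemma descent_tops_not_in:
  assumes "w5 = [] \<or> x < hd w5" "x \<notin> set w1" "x \<notin> set w5"
  shows "x \<notin> descent_tops (w1 @ x # w5)"
  using assms descent_tops_subset[of w1] descent_tops_subset[of w5]
  by (auto simp: descent_tops_append descent_tops_Cons_greater split: if_splits)

lemma descent_top_in:
  assumes "w \<noteq> []" "hd w < x"
  shows "x \<in> descent_tops (w1 @ x # w)"
  using assms by (cases w) (auto simp: descent_tops_append descent_tops_Cons)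

section \<open>The x-factorization and the effect of one involution on the two sets\<close>

text \<open>A declarative form of the x-factorization in which the symmetry between
  \<open>w2\<close> and \<open>w4\<close> is visible; the two lemmas on uniqueness and existence
  connect it with the computed one.\<close>

definition is_x_factorization ::
    "nat \<Rightarrow> nat list \<Rightarrow> nat list \<Rightarrow> nat list \<Rightarrow> nat list \<Rightarrow> bool" where
  "is_x_factorization x w1 w2 w4 w5 \<longleftrightarrow> x \<notin> set (w1 @ w2 @ w4 @ w5) \<and>
     (\<forall>z\<in>set (w2 @ w4). z < x) \<and> (w1 = [] \<or> x < last w1) \<and> (w5 = [] \<or> x < hd w5)"

lemma x_factorization_eq:
  assumes "is_x_factorization x w1 w2 w4 w5"
  shows "x_factorization x (w1 @ w2 @ x # w4 @ w5) = (w1, w2, w4, w5)"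
proof -
  have x: "z \<noteq> x" if "z \<in> set (w1 @ w2)" for z
    using assms that by (auto simp: is_x_factorization_def)
  have l: "takeWhile (\<lambda>z. z \<noteq> x) (w1 @ w2 @ x # w4 @ w5) = w1 @ w2"
    "dropWhile (\<lambda>z. z \<noteq> x) (w1 @ w2 @ x # w4 @ w5) = x # w4 @ w5"
    using takeWhile_append2[of "w1 @ w2" "\<lambda>z. z \<noteq> x" "x # w4 @ w5", OF x]
      dropWhile_append2[of "w1 @ w2" "\<lambda>z. z \<noteq> x" "x # w4 @ w5", OF x]
    by simp_all
  have small: "takeWhile (\<lambda>z. z < x) (rev w2 @ v) = rev w2 @ takeWhile (\<lambda>z. z < x) v"
    "dropWhile (\<lambda>z. z < x) (rev w2 @ v) = dropWhile (\<lambda>z. z < x) v"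
    "takeWhile (\<lambda>z. z < x) (w4 @ v) = w4 @ takeWhile (\<lambda>z. z < x) v"
    "dropWhile (\<lambda>z. z < x) (w4 @ v) = dropWhile (\<lambda>z. z < x) v" for v
    using assms by (auto intro!: takeWhile_append2 dropWhile_append2 simp: is_x_factorization_def)
  have "takeWhile (\<lambda>z. z < x) (rev w1) = []" "dropWhile (\<lambda>z. z < x) (rev w1) = rev w1"
    using assms by (cases w1 rule: rev_cases; auto simp: is_x_factorization_def)+
  moreover have "takeWhile (\<lambda>z. z < x) w5 = []" "dropWhile (\<lambda>z. z < x) w5 = w5"
    using assms by (cases w5; auto simp: is_x_factorization_def)+
  ultimately show ?thesis
    by (simp add: x_factorization_def l Let_def small)
qed

lemma x_factorization_exists:
  assumes "distinct \<pi>" "x \<in> set \<pi>"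
  obtains w1 w2 w4 w5 where "is_x_factorization x w1 w2 w4 w5" "\<pi> = w1 @ w2 @ x # w4 @ w5"
proof -
  obtain l r where \<pi>: "\<pi> = l @ x # r" using assms(2) by (meson split_list)
  then have x: "x \<notin> set l" "x \<notin> set r" using assms(1) by auto
  define w1 w2 w4 w5 where w: "w1 = rev (dropWhile (\<lambda>z. z < x) (rev l))"
    "w2 = rev (takeWhile (\<lambda>z. z < x) (rev l))"
    "w4 = takeWhile (\<lambda>z. z < x) r" "w5 = dropWhile (\<lambda>z. z < x) r"
  have l: "l = w1 @ w2" unfolding w by (metis rev_append rev_rev_ident takeWhile_dropWhile_id)
  have r: "r = w4 @ w5" by (simp add: w)
  have "w1 = [] \<or> x < last w1"
  proof (cases "w1 = []")
    case False
    then have "\<not> last w1 < x" using hd_dropWhile[of "\<lambda>z. z < x" "rev l"] by (simp add: w last_rev)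
    moreover have "last w1 \<noteq> x" using x l False by (metis UnCI last_in_set set_append)
    ultimately show ?thesis by (meson linorder_less_linear)
  qed simp
  moreover have "w5 = [] \<or> x < hd w5"
  proof (cases "w5 = []")
    case False
    then have "\<not> hd w5 < x" using hd_dropWhile[of "\<lambda>z. z < x" r] by (simp add: w)
    moreover have "hd w5 \<noteq> x" using x r False by (metis UnCI hd_in_set set_append)
    ultimately show ?thesis by (meson linorder_less_linear)
  qed simp
  moreover have "\<forall>z\<in>set (w2 @ w4). z < x"
    by (auto simp: w dest: set_takeWhileD)
  ultimately have "is_x_factorization x w1 w2 w4 w5"
    using x l r by (auto simp: is_x_factorization_def)
  then show thesis using that \<pi> l r by simp
qed

lemma is_x_factorization_swap:
  "is_x_factorization x w1 w2 w4 w5 \<Longrightarrow> is_x_factorization x w1 w4 w2 w5"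
  by (auto simp: is_x_factorization_def)

lemma modified_FS_eq:
  assumes "is_x_factorization x w1 w2 w4 w5"
  shows "modified_FS x (w1 @ w2 @ x # w4 @ w5) =
    (if (w2 = []) \<noteq> (w4 = []) then w1 @ w4 @ x # w2 @ w5 else w1 @ w2 @ x # w4 @ w5)"
  using x_factorization_eq[OF assms] by (simp add: modified_FS_def FS_def)

text \<open>Exchanging \<open>w2\<close> and \<open>w4\<close> yields the x-factorization of the new
  word, and the condition for exchanging them is symmetric, so a second application undoes the
  first.\<close>

lemma modified_FS_involution:
  assumes "distinct \<pi>" "x \<in> set \<pi>"
  shows "modified_FS x (modified_FS x \<pi>) = \<pi>"
proof -
  obtain w1 w2 w4 w5 where w: "is_x_factorization x w1 w2 w4 w5" "\<pi> = w1 @ w2 @ x # w4 @ w5"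
    using x_factorization_exists assms by metis
  show ?thesis
    using modified_FS_eq[OF w(1)] modified_FS_eq[OF is_x_factorization_swap[OF w(1)]]
    by (auto simp: w(2))
qed

text \<open>The letter \<open>x\<close> is a double descent of \<open>\<pi>\<close> and a double
  ascent of \<open>\<pi>'\<close>, with infinity at both ends; no other letter changes its
  status.\<close>

lemma descent_tops_shift:
  assumes w: "is_x_factorization x w1 [] w4 w5" "w4 \<noteq> []"
  defines "\<pi> \<equiv> w1 @ x # w4 @ w5" and "\<pi>' \<equiv> w1 @ w4 @ x # w5"
  shows "descent_tops \<pi> = insert x (descent_tops \<pi>')" "x \<notin> descent_tops \<pi>'"
    "descent_tops (rev \<pi>') = insert x (descent_tops (rev \<pi>))" "x \<notin> descent_tops (rev \<pi>)"
proof -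
  note [simp] = \<pi>_def \<pi>'_def
  show "descent_tops \<pi> = insert x (descent_tops \<pi>')"
    using w by (simp add: is_x_factorization_def descent_tops_move)
  show "x \<notin> descent_tops \<pi>'"
    using w descent_tops_not_in[of w5 x "w1 @ w4"] by (auto simp: is_x_factorization_def)
  \<comment> \<open>In the reversed words \<open>x\<close> moves across \<open>rev w4\<close> in the
    opposite direction, so the two words exchange roles.\<close>
  show "descent_tops (rev \<pi>') = insert x (descent_tops (rev \<pi>))"
    using w descent_tops_move[of "rev w4" x "rev w5" "rev w1"]
    by (simp add: is_x_factorization_def last_rev hd_rev)
  show "x \<notin> descent_tops (rev \<pi>)"
    using w descent_tops_not_in[of "rev w1" x "rev w5 @ rev w4"]
    by (auto simp: is_x_factorization_def hd_rev)
qed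

lemma modified_FS_descent_tops:
  assumes "distinct \<pi>" "x \<in> set \<pi>"
  defines "\<pi>' \<equiv> modified_FS x \<pi>"
  shows "descent_tops \<pi>' - {x} = descent_tops \<pi> - {x}"
    and "descent_tops (rev \<pi>') - {x} = descent_tops (rev \<pi>) - {x}"
    and "x \<in> descent_tops \<pi>' \<longleftrightarrow> x \<in> descent_tops (rev \<pi>)"
    and "x \<in> descent_tops (rev \<pi>') \<longleftrightarrow> x \<in> descent_tops \<pi>"
proof -
  obtain w1 w2 w4 w5 where w: "is_x_factorization x w1 w2 w4 w5" "\<pi> = w1 @ w2 @ x # w4 @ w5"
    using x_factorization_exists assms(1,2) by metis
  consider (same) "(w2 = []) = (w4 = [])" | (right) "w2 = []" "w4 \<noteq> []"
    | (left) "w2 \<noteq> []" "w4 = []"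
    by blast
  then have "descent_tops \<pi>' - {x} = descent_tops \<pi> - {x} \<and>
    descent_tops (rev \<pi>') - {x} = descent_tops (rev \<pi>) - {x} \<and>
    (x \<in> descent_tops \<pi>' \<longleftrightarrow> x \<in> descent_tops (rev \<pi>)) \<and>
    (x \<in> descent_tops (rev \<pi>') \<longleftrightarrow> x \<in> descent_tops \<pi>)"
  proof cases
    case same
    then have "\<pi>' = \<pi>"
      using modified_FS_eq[OF w(1)] by (simp add: w(2) \<pi>'_def)
    \<comment> \<open>Here \<open>x\<close> is a valley if both words are empty and a peak if both
      are nonempty; it lies in neither set or in both.\<close>
    have "x \<in> descent_tops \<pi> \<longleftrightarrow> x \<in> descent_tops (rev \<pi>)"
    proof (cases "w2 = []")
      case True
      have "x \<notin> descent_tops (w1 @ x # w5)" "x \<notin> descent_tops (rev w5 @ x # rev w1)"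
        by (rule descent_tops_not_in; use w(1) in \<open>auto simp: is_x_factorization_def hd_rev\<close>)+
      then show ?thesis using True same w(2) by simp
    next
      case False
      then have "w4 \<noteq> []" using same by simp
      then have "hd (w4 @ w5) < x" "hd (rev w2 @ rev w1) < x"
        using False w(1) by (simp_all add: is_x_factorization_def hd_rev)
      then have "x \<in> descent_tops ((w1 @ w2) @ x # w4 @ w5)"
        "x \<in> descent_tops ((rev w5 @ rev w4) @ x # rev w2 @ rev w1)"
        using False \<open>w4 \<noteq> []\<close> by (intro descent_top_in; simp)+
      then show ?thesis using w(2) by simp
    qed
    then show ?thesis using \<open>\<pi>' = \<pi>\<close> by simp
  next
    case right
    have \<pi>: "\<pi> = w1 @ x # w4 @ w5" and \<pi>': "\<pi>' = w1 @ w4 @ x # w5"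
      using modified_FS_eq[OF w(1)] right by (simp_all add: w(2) \<pi>'_def)
    have "is_x_factorization x w1 [] w4 w5" using w(1) right by simp
    note descent_tops_shift[OF this right(2), folded \<pi> \<pi>']
    then show ?thesis by blast
  next
    case left
    have \<pi>: "\<pi> = w1 @ w2 @ x # w5" and \<pi>': "\<pi>' = w1 @ x # w2 @ w5"
      using modified_FS_eq[OF w(1)] left by (simp_all add: w(2) \<pi>'_def)
    have "is_x_factorization x w1 [] w2 w5"
      using is_x_factorization_swap[OF w(1)] left by simp
    note descent_tops_shift[OF this left(1), folded \<pi> \<pi>']
    then show ?thesis by blast
  qed
  then show "descent_tops \<pi>' - {x} = descent_tops \<pi> - {x}"
    and "descent_tops (rev \<pi>') - {x} = descent_tops (rev \<pi>) - {x}"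
    and "x \<in> descent_tops \<pi>' \<longleftrightarrow> x \<in> descent_tops (rev \<pi>)"
    and "x \<in> descent_tops (rev \<pi>') \<longleftrightarrow> x \<in> descent_tops \<pi>"
    by blast+
qed

section \<open>Averaging over the action\<close>

lemma modified_FS_set_singleton: "modified_FS_set {x} = modified_FS x"
  by (simp add: modified_FS_set_def fun_eq_iff)

text \<open>
  The letters that are neither peaks nor valleys are independent: \<^term>\<open>modified_FS x\<close> exchanges
  the weights \<open>1\<close> and \<open>t\<close> of the letter \<open>x\<close>, so either may be replaced by their mean \<open>h\<close>.
\<close>

lemma P_pk_des_symmetrized:
  fixes c t h :: "'a :: field"
  assumes \<Omega>: "\<Omega> \<subseteq> permutations_of_set {1..n}" "MFS_invariant n \<Omega>"
    and h: "2 * h = 1 + t" "(2 :: 'a) \<noteq> 0"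
  shows "P_pk_des \<Omega> c t = (\<Sum>\<pi>\<in>\<Omega>. (c * t) ^ (pk \<pi> + 1) * h ^ (n - 1 - 2 * pk \<pi>))"
proof -
  \<comment> \<open>\<open>B\<close> collects the double descents and \<open>C\<close> the double
    ascents, with infinity at both ends of the word.\<close>
  define B where "B \<pi> = descent_tops \<pi> - descent_tops (rev \<pi>)" for \<pi> :: "nat list"
  define C where "C \<pi> = descent_tops (rev \<pi>) - descent_tops \<pi>" for \<pi> :: "nat list"
  \<comment> \<open>\<open>W S\<close> is the weight in which the letters of \<open>S\<close> have already been averaged.\<close>
  define W where "W S \<pi> = (c * t) ^ (pk \<pi> + 1) * t ^ card (B \<pi> - S) * h ^ card (S \<inter> (B \<pi> \<union> C \<pi>))"
    for S \<pi>
  have fin [simp]: "finite (B \<pi>)" "finite (C \<pi>)" for \<pi> by (auto simp: B_def C_def)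
  have perm: "distinct \<pi>" "set \<pi> = {1..n}" "length \<pi> = n" if "\<pi> \<in> \<Omega>" for \<pi>
    using that \<Omega>(1) length_finite_permutations_of_set[of \<pi> "{1..n}"]
    by (auto simp: permutations_of_set_def)
  have step: "sum (W S) \<Omega> = sum (W (insert x S)) \<Omega>"
    if x: "x \<in> {1..n}" "x \<notin> S" and S: "finite S" for x S
  proof -
    let ?\<phi> = "modified_FS x"
    have maps: "?\<phi> \<pi> \<in> \<Omega>" if "\<pi> \<in> \<Omega>" for \<pi>
      using \<Omega>(2) that x(1) unfolding MFS_invariant_def
      by (metis empty_subsetI insert_subset modified_FS_set_singleton)
    \<comment> \<open>The involution permutes \<open>\<Omega>\<close>, so the sum may be reindexed
      along it; adding both versions pairs each word with its image.\<close>
    have "sum (W S) \<Omega> = (\<Sum>\<pi>\<in>\<Omega>. W S (?\<phi> \<pi>))"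
      by (rule sum.reindex_bij_witness[of _ ?\<phi> ?\<phi>]) (use maps modified_FS_involution perm x in auto)
    then have "2 * sum (W S) \<Omega> = (\<Sum>\<pi>\<in>\<Omega>. W S \<pi> + W S (?\<phi> \<pi>))"
      by (simp add: sum.distrib)
    also have "\<dots> = (\<Sum>\<pi>\<in>\<Omega>. 2 * W (insert x S) \<pi>)"
    proof (rule sum.cong[OF refl])
      fix \<pi> assume \<pi>: "\<pi> \<in> \<Omega>"
      have x\<pi>: "x \<in> set \<pi>" using perm(2)[OF \<pi>] x(1) by simp
      note tops = modified_FS_descent_tops[OF perm(1)[OF \<pi>] x\<pi>]
      have "descent_tops (?\<phi> \<pi>) \<inter> descent_tops (rev (?\<phi> \<pi>)) = descent_tops \<pi> \<inter> descent_tops (rev \<pi>)"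
        using tops by blast
      then have pk: "pk (?\<phi> \<pi>) = pk \<pi>"
        using perm[OF \<pi>] perm[OF maps[OF \<pi>]] by (simp add: pk_eq_card)
      have BC: "B (?\<phi> \<pi>) - {x} = B \<pi> - {x}" "B (?\<phi> \<pi>) \<union> C (?\<phi> \<pi>) = B \<pi> \<union> C \<pi>"
        "x \<in> B (?\<phi> \<pi>) \<longleftrightarrow> x \<in> C \<pi>" "B \<pi> \<inter> C \<pi> = {}"
        using tops unfolding B_def C_def by blast+
      define b k f where "b = card (B \<pi> - insert x S)" and "k = card (S \<inter> (B \<pi> \<union> C \<pi>))"
        and "f = (c * t) ^ (pk \<pi> + 1) * t ^ b * h ^ k"
      \<comment> \<open>This separates the contribution of \<open>x\<close> to the exponent of
        \<open>t\<close> from that of the other letters.\<close>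
      have card_B: "card (X - S) = (if x \<in> X then Suc (card (X - insert x S)) else card (X - insert x S))"
        if "finite X" for X
      proof -
        have "X - S - {x} = X - insert x S" by blast
        then show ?thesis
          using card_Suc_Diff1[of "X - S" x] x that by (cases "x \<in> X") simp_all
      qed
      have "B (?\<phi> \<pi>) - insert x S = B \<pi> - insert x S" using BC(1) by blast
      then have "W S \<pi> = (if x \<in> B \<pi> then t * f else f)"
        "W S (?\<phi> \<pi>) = (if x \<in> C \<pi> then t * f else f)"
        by (simp_all only: W_def card_B[OF fin(1)] BC pk b_def[symmetric] k_def[symmetric] f_def
            power_Suc split: if_split) (simp_all add: mult_ac)
      moreover have W_insert: "W (insert x S) \<pi> = (if x \<in> B \<pi> \<union> C \<pi> then h * f else f)"
      proof -
        have "insert x S \<inter> (B \<pi> \<union> C \<pi>) =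
            (if x \<in> B \<pi> \<union> C \<pi> then insert x (S \<inter> (B \<pi> \<union> C \<pi>)) else S \<inter> (B \<pi> \<union> C \<pi>))"
          by auto
        then have "card (insert x S \<inter> (B \<pi> \<union> C \<pi>)) = (if x \<in> B \<pi> \<union> C \<pi> then Suc k else k)"
          using x S by (simp add: k_def)
        then show ?thesis by (simp add: W_def b_def f_def)
      qed
      \<comment> \<open>As \<open>B \<pi>\<close> and \<open>C \<pi>\<close> are disjoint, a letter
        \<open>x\<close> in their union gives the factor \<open>t\<close> to exactly one of the two
        weights. The sum \<open>1 + t\<close> is then \<open>2 * h\<close>.\<close>
      ultimately have "W S \<pi> + W S (?\<phi> \<pi>) = (if x \<in> B \<pi> \<union> C \<pi> then (1 + t) * f else 2 * f)"
        using BC(4) by (auto simp: distrib_right)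
      then show "W S \<pi> + W S (?\<phi> \<pi>) = 2 * W (insert x S) \<pi>"
        unfolding W_insert h(1)[symmetric] by simp
    qed
    finally show ?thesis using h(2) by (simp add: sum_distrib_left[symmetric])
  qed
  \<comment> \<open>One letter is averaged at a time, from the original weight \<open>W {}\<close>
    to the fully averaged \<open>W {1..n}\<close>.\<close>
  have "sum (W {}) \<Omega> = sum (W S) \<Omega>" if "finite S" "S \<subseteq> {1..n}" for S
    using that by (induction S rule: finite_induct) (simp_all add: step)
  then have "sum (W {}) \<Omega> = sum (W {1..n}) \<Omega>" by simp
  moreover have "W {} \<pi> = c ^ (pk \<pi> + 1) * t ^ (des \<pi> + 1)" if "\<pi> \<in> \<Omega>" for \<pi>
  proof -
    have "des \<pi> = pk \<pi> + card (B \<pi>)"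
      unfolding B_def des_eq_card_descent_tops[OF perm(1)[OF that]] pk_eq_card[OF perm(1)[OF that]]
      by (subst card_Un_disjoint[symmetric]) (auto intro: arg_cong[where f = card])
    then show ?thesis by (simp add: W_def power_mult_distrib power_add mult_ac)
  qed
  moreover have "W {1..n} \<pi> = (c * t) ^ (pk \<pi> + 1) * h ^ (n - 1 - 2 * pk \<pi>)" if "\<pi> \<in> \<Omega>" for \<pi>
  proof -
    let ?D = "descent_tops \<pi>" and ?A = "descent_tops (rev \<pi>)"
    \<comment> \<open>Peaks are counted in both \<open>?D\<close> and \<open>?A\<close>, whose sizes
      add up to \<open>n - 1\<close>; discarding them from both leaves
      \<open>n - 1 - 2 * pk \<pi>\<close> letters.\<close>
    have "card ?D = card (?D \<inter> ?A) + card (B \<pi>)" "card ?A = card (?D \<inter> ?A) + card (C \<pi>)"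
      unfolding B_def C_def by (subst card_Un_disjoint[symmetric]; auto intro: arg_cong[where f = card])+
    moreover have "card (B \<pi> \<union> C \<pi>) = card (B \<pi>) + card (C \<pi>)"
      by (rule card_Un_disjoint) (auto simp: B_def C_def)
    ultimately have "card (B \<pi> \<union> C \<pi>) = n - 1 - 2 * pk \<pi>"
      using card_descent_tops_rev[of \<pi>] perm[OF that] by (simp add: pk_eq_card)
    moreover have "B \<pi> \<subseteq> {1..n}" "C \<pi> \<subseteq> {1..n}"
      using descent_tops_subset[of \<pi>] descent_tops_subset[of "rev \<pi>"] perm[OF that] by (auto simp: B_def C_def)
    then have sub: "{1..n} \<inter> (B \<pi> \<union> C \<pi>) = B \<pi> \<union> C \<pi>" "B \<pi> - {1..n} = {}" by auto
    ultimately show ?thesis unfolding W_def sub by simp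
  qed
  ultimately show ?thesis by (simp add: P_pk_des_def)
qed

section \<open>Homogeneity of the averaged sum\<close>

text \<open>The peaks lie in two sets whose sizes add up to \<open>length \<pi> - 1\<close>. The
  bound makes the exponent \<open>n - 1 - 2 * pk \<pi>\<close> a true difference rather than a
  truncated one.\<close>

lemma pk_bound:
  assumes "distinct \<pi>" "\<pi> \<noteq> []"
  shows "2 * pk \<pi> + 1 \<le> length \<pi>"
proof -
  have "pk \<pi> \<le> card (descent_tops \<pi>)" "pk \<pi> \<le> card (descent_tops (rev \<pi>))"
    unfolding pk_eq_card[OF assms(1)] by (auto intro: card_mono)
  then show ?thesis
    using card_descent_tops_rev[OF assms(1)] assms(2) by (cases \<pi>) auto
qed

text \<open>If \<open>c * t\<close> has degree 2 and \<open>h\<close> degree 1, each summand of the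
  averaged form has degree \<open>2 * (pk \<pi> + 1) + (n - 1 - 2 * pk \<pi>) = n + 1\<close>.
  Setting \<open>c = 1\<close> forgets the peaks and leaves \<open>A_poly\<close>.\<close>

lemma P_pk_des_eq_A_poly:
  fixes \<alpha> t y T :: "'a :: field"
  assumes "n \<ge> 1" and \<Omega>: "\<Omega> \<subseteq> permutations_of_set {1..n}" "MFS_invariant n \<Omega>"
    and "(2 :: 'a) \<noteq> 0" and yT: "y * T = \<alpha>\<^sup>2 * t" "1 + T = \<alpha> * (1 + t)"
  shows "P_pk_des \<Omega> y T = \<alpha> ^ (n + 1) * A_poly \<Omega> t"
proof -
  define h where "h = (1 + t) / 2"
  have h: "2 * h = 1 + t" "2 * (\<alpha> * h) = 1 + T"
    using assms(4) yT(2) by (simp_all add: h_def)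
  have "P_pk_des \<Omega> y T = (\<Sum>\<pi>\<in>\<Omega>. (y * T) ^ (pk \<pi> + 1) * (\<alpha> * h) ^ (n - 1 - 2 * pk \<pi>))"
    by (rule P_pk_des_symmetrized[OF \<Omega> h(2) assms(4)])
  also have "\<dots> = (\<Sum>\<pi>\<in>\<Omega>. \<alpha> ^ (n + 1) * ((1 * t) ^ (pk \<pi> + 1) * h ^ (n - 1 - 2 * pk \<pi>)))"
  proof (rule sum.cong[OF refl])
    fix \<pi> assume "\<pi> \<in> \<Omega>"
    then have "distinct \<pi>" "length \<pi> = n"
      using \<Omega>(1) length_finite_permutations_of_set[of \<pi> "{1..n}"]
      by (auto simp: permutations_of_set_def)
    moreover from this have "\<pi> \<noteq> []" using assms(1) by auto
    ultimately have "n + 1 = 2 * (pk \<pi> + 1) + (n - 1 - 2 * pk \<pi>)"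
      using pk_bound[of \<pi>] by simp
    then have \<alpha>: "\<alpha> ^ (n + 1) = (\<alpha>\<^sup>2) ^ (pk \<pi> + 1) * \<alpha> ^ (n - 1 - 2 * pk \<pi>)"
      unfolding power_mult[symmetric] power_add[symmetric] by (rule arg_cong)
    show "(y * T) ^ (pk \<pi> + 1) * (\<alpha> * h) ^ (n - 1 - 2 * pk \<pi>) =
        \<alpha> ^ (n + 1) * ((1 * t) ^ (pk \<pi> + 1) * h ^ (n - 1 - 2 * pk \<pi>))"
      unfolding yT(1) \<alpha> mult_1_left power_mult_distrib by (simp only: mult_ac)
  qed
  also have "\<dots> = \<alpha> ^ (n + 1) * P_pk_des \<Omega> 1 t"
    by (simp add: P_pk_des_symmetrized[OF \<Omega> h(1) assms(4)] sum_distrib_left)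
  finally show ?thesis by (simp add: P_pk_des_def A_poly_def)
qed

section \<open>The series u and v\<close>

lemma fps_unit_ex:
  fixes f :: "'a :: comm_ring_1 fps"
  assumes "fps_nth f 0 * c = 1"
  obtains g where "f * g = 1"
  using fps_right_inverse[OF assms] by blast

lemma to_fract_numeral: "to_fract (numeral k) = numeral k"
  by (induct k rule: num.induct) (simp_all only: numeral.simps to_fract_add to_fract_1)

text \<open>With \<open>g\<close> the inverse of the unit \<open>f'\<close>, one has
  \<open>f = q * q * g\<close>, so \<open>q\<close> divides \<open>f\<close>. This handles factors
  \<open>y\<close> and \<open>1 - y\<close> of \<open>q\<close> together with \<open>t\<close>; none
  of them is invertible over the coefficient ring of polynomials in \<open>y\<close>.\<close>

lemma conjugate_quotient_in_range_to_fract: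
  fixes f f' q :: "rat poly fps"
  assumes "f * f' = q * q" "q \<noteq> 0" "fps_nth f' 0 = 2" "fps_nth q 0 = 0"
  obtains r where "to_fract f / to_fract q = to_fract r" "fps_nth r 0 = 0"
proof -
  have "fps_nth f' 0 * [:1 / 2:] = 1"
    unfolding assms(3) by (simp add: numeral_poly one_pCons)
  then obtain g where g: "f' * g = 1" by (rule fps_unit_ex)
  have "f = f * f' * g" using g by (simp add: mult.assoc)
  then have "f = q * (q * g)" using assms(1) by (simp add: mult.assoc)
  then have "to_fract f = to_fract q * to_fract (q * g)" by (metis to_fract_mult)
  then have "to_fract f / to_fract q = to_fract (q * g)" using assms(2) by simp
  moreover have "fps_nth (q * g) 0 = 0" using assms(4) by simp
  ultimately show thesis by (rule that)
qed

text \<open>Two relations suffice: \<open>y * t * (1 + v)\<^sup>2 = (1 + t)\<^sup>2 * v\<close> and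
  \<open>u * (1 - t * v) = t - v\<close>. They give the two scaling conditions with
  \<open>\<alpha> = (1 + u) / (1 + u * v)\<close>.\<close>

lemma u_v_algebra:
  fixes y t s u v :: "'a :: field"
  assumes s: "s\<^sup>2 = (1 + t)\<^sup>2 - 4 * y * t"
    and nz: "(2 :: 'a) \<noteq> 0" "y \<noteq> 0" "t \<noteq> 0" "1 - y \<noteq> 0"
    and u: "u = (1 + t\<^sup>2 - 2 * y * t - (1 - t) * s) / (2 * (1 - y) * t)"
    and v: "v = ((1 + t)\<^sup>2 - 2 * y * t - (1 + t) * s) / (2 * y * t)"
    and nz': "1 + v \<noteq> 0" "1 + u * v \<noteq> 0"
  defines "\<alpha> \<equiv> (1 + u) / (1 + u * v)"
  shows "y * t = \<alpha>\<^sup>2 * v" "1 + t = \<alpha> * (1 + v)"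
proof -
  define M N where "M = 1 + t\<^sup>2 - 2 * y * t - (1 - t) * s" and "N = (1 + t)\<^sup>2 - 2 * y * t - (1 + t) * s"
  have uM: "2 * (1 - y) * t * u = M" and vN: "2 * y * t * v = N"
    using nz unfolding u v M_def N_def by simp_all
  \<comment> \<open>The quadratic equation whose roots are \<open>N\<close> and its conjugate under
    \<open>s \<mapsto> - s\<close>; the product of the roots is
    \<open>(2 * y * t)\<^sup>2\<close>.\<close>
  have "N\<^sup>2 - 2 * ((1 + t)\<^sup>2 - 2 * y * t) * N + 4 * y\<^sup>2 * t\<^sup>2 = 0"
    using s unfolding N_def by algebra
  then have "4 * y * t * (y * t * (1 + v)\<^sup>2) = 4 * y * t * ((1 + t)\<^sup>2 * v)"
    unfolding vN[symmetric] by algebra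
  moreover have four: "(4 :: 'a) \<noteq> 0" using nz(1) by (metis mult_eq_0_iff mult_2 numeral_Bit0)
  ultimately have v2: "y * t * (1 + v)\<^sup>2 = (1 + t)\<^sup>2 * v" using nz by simp
  \<comment> \<open>The relation \<open>u * (1 - t * v) = t - v\<close> with denominators
    cleared.\<close>
  have "M * (2 * y - N) = 2 * (1 - y) * (2 * y * t\<^sup>2 - N)"
    using s unfolding M_def N_def by algebra
  then have "4 * (1 - y) * y * t * (u * (1 - t * v)) = 4 * (1 - y) * y * t * (t - v)"
    unfolding uM[symmetric] vN[symmetric] by algebra
  then have "u * (1 - t * v) = t - v" using nz four by simp
  then have "(1 + t) * (1 + u * v) = (1 + u) * (1 + v)" by algebra
  then show 1: "1 + t = \<alpha> * (1 + v)" using nz' by (simp add: \<alpha>_def field_simps)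
  \<comment> \<open>The quadratic relation for \<open>v\<close>, with \<open>1 + t\<close> replaced
    by \<open>\<alpha> * (1 + v)\<close>, becomes the other condition once the square is
    cancelled.\<close>
  have "(1 + v)\<^sup>2 * (y * t) = (1 + v)\<^sup>2 * (\<alpha>\<^sup>2 * v)"
    using v2 unfolding 1 by (simp add: power_mult_distrib mult_ac)
  then show "y * t = \<alpha>\<^sup>2 * v" using nz' by simp
qed

lemma u_v_ser_series:
  obtains U V where "u_ser = to_fract U" "v_ser = to_fract V" "fps_nth U 0 = 0" "fps_nth V 0 = 0"
proof -
  let ?y = "fps_const [:0, 1:] :: rat poly fps" and ?t = "fps_X :: rat poly fps" and ?s = sqrt_disc
  have s: "?s\<^sup>2 = (1 + ?t)\<^sup>2 - 4 * ?y * ?t"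
    using sqrt_disc_square by (simp add: disc_def)
  have two: "(2 :: rat poly fps) \<noteq> 0"
    by (metis fps_numeral_nth_0 fps_zero_nth zero_neq_numeral)
  have y: "?y \<noteq> 0" "1 - ?y \<noteq> 0"
    by (auto simp: fps_eq_iff one_pCons intro!: exI[of _ 0])
  have t: "?t \<noteq> 0" by simp
  note tf = u_ser_def v_ser_def y_ser_def t_ser_def power2_eq_square to_fract_numeral
  have "(1 + ?t\<^sup>2 - 2 * ?y * ?t - (1 - ?t) * ?s) * (1 + ?t\<^sup>2 - 2 * ?y * ?t + (1 - ?t) * ?s) =
      (2 * (1 - ?y) * ?t) * (2 * (1 - ?y) * ?t)"
    using s by algebra
  then obtain U where "u_ser = to_fract U" "fps_nth U 0 = 0"
  proof (rule conjugate_quotient_in_range_to_fract)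
    show "2 * (1 - ?y) * ?t \<noteq> 0" using two y t by simp
  qed (simp_all add: tf sqrt_disc_nth_0)
  moreover have "((1 + ?t)\<^sup>2 - 2 * ?y * ?t - (1 + ?t) * ?s) *
      ((1 + ?t)\<^sup>2 - 2 * ?y * ?t + (1 + ?t) * ?s) =
      (2 * ?y * ?t) * (2 * ?y * ?t)"
    using s by algebra
  then obtain V where "v_ser = to_fract V" "fps_nth V 0 = 0"
  proof (rule conjugate_quotient_in_range_to_fract)
    show "2 * ?y * ?t \<noteq> 0" using two y t by simp
  qed (simp_all add: tf sqrt_disc_nth_0)
  ultimately show thesis using that by blast
qed

section \<open>The two identities\<close>

lemma rational_function_nonzero:
  "(2 :: rat poly poly fract) \<noteq> 0" "1 + y_rat \<noteq> 0" "1 + y_rat * t_rat \<noteq> 0" "y_rat + t_rat \<noteq> 0"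
proof -
  have "1 + y_rat = to_fract (1 + [:[:0, 1:]:])"
    "1 + y_rat * t_rat = to_fract (1 + [:[:0, 1:]:] * [:0, 1:])"
    "y_rat + t_rat = to_fract ([:[:0, 1:]:] + [:0, 1:])"
    by (simp_all only: y_rat_def t_rat_def to_fract_add to_fract_mult to_fract_1)
  then show "1 + y_rat \<noteq> 0" "1 + y_rat * t_rat \<noteq> 0" "y_rat + t_rat \<noteq> 0"
    by (simp_all add: one_pCons del: to_fract_add to_fract_mult)
  show "(2 :: rat poly poly fract) \<noteq> 0"
    unfolding to_fract_numeral[symmetric] to_fract_eq_0_iff by simp
qed

theorem theorem5p1:
  fixes n :: nat and \<Omega> :: "nat list set"
  assumes "n \<ge> 1"
    and "\<Omega> \<subseteq> permutations_of_set {1..n}"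
    and "MFS_invariant n \<Omega>"
  shows "A_poly \<Omega> t_rat =
           ((1 + y_rat * t_rat) / (1 + y_rat)) ^ (n + 1) *
           P_pk_des \<Omega> ((1 + y_rat)\<^sup>2 * t_rat / ((y_rat + t_rat) * (1 + y_rat * t_rat)))
                      ((y_rat + t_rat) / (1 + y_rat * t_rat))
       \<and> u_ser \<in> range to_fract \<and> v_ser \<in> range to_fract
       \<and> P_pk_des \<Omega> y_ser t_ser =
           ((1 + u_ser) / (1 + u_ser * v_ser)) ^ (n + 1) * A_poly \<Omega> v_ser"
proof (intro conjI)
  \<comment> \<open>The reciprocal of the factor in the statement, since the scaling lemma expresses
    \<open>P_pk_des\<close> through \<open>A_poly\<close>.\<close>
  define \<alpha> where "\<alpha> = (1 + y_rat) / (1 + y_rat * t_rat)"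
  note nz = rational_function_nonzero
  have "P_pk_des \<Omega> ((1 + y_rat)\<^sup>2 * t_rat / ((y_rat + t_rat) * (1 + y_rat * t_rat)))
      ((y_rat + t_rat) / (1 + y_rat * t_rat)) = \<alpha> ^ (n + 1) * A_poly \<Omega> t_rat"
  proof (rule P_pk_des_eq_A_poly[OF assms nz(1)])
    show "(1 + y_rat)\<^sup>2 * t_rat / ((y_rat + t_rat) * (1 + y_rat * t_rat)) *
        ((y_rat + t_rat) / (1 + y_rat * t_rat)) = \<alpha>\<^sup>2 * t_rat"
      using nz by (simp add: \<alpha>_def power2_eq_square)
    show "1 + (y_rat + t_rat) / (1 + y_rat * t_rat) = \<alpha> * (1 + t_rat)"
      using nz by (simp add: \<alpha>_def add_divide_eq_iff) (simp add: algebra_simps)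
  qed
  moreover have "((1 + y_rat * t_rat) / (1 + y_rat)) ^ (n + 1) * \<alpha> ^ (n + 1) = 1"
    unfolding \<alpha>_def power_mult_distrib[symmetric] using nz by simp
  ultimately show "A_poly \<Omega> t_rat = ((1 + y_rat * t_rat) / (1 + y_rat)) ^ (n + 1) *
      P_pk_des \<Omega> ((1 + y_rat)\<^sup>2 * t_rat / ((y_rat + t_rat) * (1 + y_rat * t_rat)))
        ((y_rat + t_rat) / (1 + y_rat * t_rat))"
    by (simp only: mult.assoc[symmetric] mult_1_left)
next
  obtain U V where UV: "u_ser = to_fract U" "v_ser = to_fract V" "fps_nth U 0 = 0" "fps_nth V 0 = 0"
    by (rule u_v_ser_series)
  then show "u_ser \<in> range to_fract" "v_ser \<in> range to_fract" by blast+
  have nz: "to_fract f \<noteq> 0" if "fps_nth f k \<noteq> 0" for f :: "rat poly fps" and k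
    using that by auto
  have s: "(to_fract sqrt_disc)\<^sup>2 = (1 + t_ser)\<^sup>2 - 4 * y_ser * t_ser"
    using arg_cong[OF sqrt_disc_square, of to_fract]
    by (simp add: disc_def y_ser_def t_ser_def power2_eq_square to_fract_numeral)
  have "(2 :: rat poly fps fract) \<noteq> 0"
    using nz[of 2 0] by (simp add: to_fract_numeral)
  moreover have "y_ser \<noteq> 0" "t_ser \<noteq> 0" "1 - y_ser \<noteq> 0"
    using nz[of "fps_const [:0, 1:]" 0] nz[of fps_X 1] nz[of "1 - fps_const [:0, 1:]" 0]
    by (simp_all add: y_ser_def t_ser_def one_pCons)
  \<comment> \<open>Both are images of series with constant term 1, because \<open>U\<close> and
    \<open>V\<close> have constant term 0.\<close>
  moreover have "1 + v_ser \<noteq> 0" "1 + u_ser * v_ser \<noteq> 0"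
    using nz[of "1 + V" 0] nz[of "1 + U * V" 0] UV by simp_all
  \<comment> \<open>The scaling lemma is applied with \<open>t_ser\<close> as its \<open>T\<close>
    and \<open>v_ser\<close> as its \<open>t\<close>.\<close>
  ultimately show "P_pk_des \<Omega> y_ser t_ser =
      ((1 + u_ser) / (1 + u_ser * v_ser)) ^ (n + 1) * A_poly \<Omega> v_ser"
    using u_v_algebra[OF s _ _ _ _ u_ser_def v_ser_def]
    by (intro P_pk_des_eq_A_poly[OF assms]) simp_all
qed

end
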